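(* Assume $F$ and the stochastic gradients satisfy the $G$-Lipschitz assumption. Let $(\gamma_t)$ be a decreasing step size sequence with at most polynomial decay with decay constant $0<\beta\le 1$. Let $T\ge 4$. Let $y_1,\dots,y_T$ be the iterates of SGD with step sizes $\gamma_t$, let $\alpha_t$ be the modification of $\gamma_t$, i.e. $\alpha_t:=2^{-i}\gamma_t$ for $T_i<t\le T_{i+1}$, $0\le i\le k$, and let $x_1,\dots,x_T$ be the iterates of SGD with step sizes $\alpha_t$. Then $$\mathbb{E}[F(x_T)]\le 5G^2\gamma_T\left(\frac{1}{\beta^2}+\frac{1}{\beta^4}\right)+\inf_{\lceil T/4\rceil\le t\le T_1}\mathbb{E}[F(y_t)].$$
   Context: Setting. $\mathcal{W}\subset\mathbb{R}^d$ is a closed convex set, $F:\mathbb{R}^d\to\mathbb{R}$ is a convex function, and $x^*\in\mathcal{W}$ is a global minimizer of $F$. $\|\cdot\|$ is the Euclidean norm, $\partial F(x)$ the subdifferential, and $\Pi_{\mathcal{W}}$ the Euclidean projection onto $\mathcal{W}$. At each time step $t$ one has access to a random map $\hat g_t$ with $\mathbb{E}[\hat g_t(x)]=g_t(x)\in\partial F(x)$ for every $x\in\mathcal{W}$; these estimates (and the noises $\hat g_t-g_t$) are independent across $t$. SGD with step sizes $\alpha_t\ge 0$: starting from a point $x_1\in\mathcal{W}$, set $x_{t+1}=\Pi_{\mathcal{W}}(x_t-\alpha_t\hat g_t(x_t))$. Both runs above start at the same point ($x_1=y_1$) and use the same stochastic gradient oracle. $G$-Lipschitz assumption: $\|g(x)\|\le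 G$ for every $x\in\mathcal{W}$ and every $g(x)\in\partial F(x)$, and $\|\hat g_t(x)\|\le G$ almost surely for every $x\in\mathcal{W}$ and every $t$. A step size sequence $(\gamma_t)_{t\ge1}$ of nonnegative reals is decreasing if $\gamma_{t+1}\le\gamma_t$ for all $t\geq 1$, and has at most polynomial decay with decay constant $0<\beta\le1$ if $\gamma_{2t}\ge\beta\gamma_t$ for every $t\ge1$. Times $T_i$: $k:=\inf\{i: T\cdot 2^{-i}\le 1\}$, $T_i:=T-\lceil T\cdot 2^{-i}\rceil$ for $0\le i\le k$, and $T_{k+1}:=T$. *)

theory Defs
  imports "HOL-Probability.Probability"
begin

definition subdifferential :: "('a::euclidean_space \<Rightarrow> real) \<Rightarrow> 'a \<Rightarrow> 'a set" where
  "subdifferential F x = {v. \<forall>z. F z \<ge> F x + v \<bullet> (z - x)}"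

text \<open>
  A random map is a function that is jointly measurable in the sample point and the spatial
  argument. A sequence of random maps is independent if the maps are jointly measurable with respect
  to independent sub-sigma-algebras (for instance those generated by independent random seeds).
  Independence of the point evaluations only would not suffice: a random map can be altered on a
  random null set of arguments without changing the law of any evaluation, but evaluating it at a
  random point such as an SGD iterate could then give anything.
  Time steps are numbered from 1.
\<close>

definition indep_random_maps ::
  "'w measure \<Rightarrow> 'a::euclidean_space set \<Rightarrow> (nat \<Rightarrow> 'w \<Rightarrow> 'a \<Rightarrow> 'a) \<Rightarrow> bool" where
  "indep_random_maps M W h \<longleftrightarrow>
     (\<exists>A :: nat \<Rightarrow> 'w measure.
        (\<forall>t\<ge>1. subalgebra M (A t)) \<and>
        prob_space.indep_sets M (\<lambda>t. sets (A t)) {1..} \<and>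
        (\<forall>t\<ge>1. (\<lambda>(\<omega>, x). h t \<omega> x) \<in> borel_measurable (A t \<Otimes>\<^sub>M restrict_space borel W)))"

definition stochastic_gradient_oracle ::
  "'w measure \<Rightarrow> 'a::euclidean_space set \<Rightarrow> ('a \<Rightarrow> real) \<Rightarrow> (nat \<Rightarrow> 'a \<Rightarrow> 'a)
     \<Rightarrow> (nat \<Rightarrow> 'w \<Rightarrow> 'a \<Rightarrow> 'a) \<Rightarrow> bool" where
  "stochastic_gradient_oracle M W F g gh \<longleftrightarrow>
     indep_random_maps M W gh \<and>
     (\<forall>t\<ge>1. \<forall>x\<in>W. has_bochner_integral M (\<lambda>\<omega>. gh t \<omega> x) (g t x)
                    \<and> g t x \<in> subdifferential F x)"

definition G_Lipschitz ::
  "'w measure \<Rightarrow> 'a::euclidean_space set \<Rightarrow> ('a \<Rightarrow> real) \<Rightarrow> (nat \<Rightarrow> 'w \<Rightarrow> 'a \<Rightarrow> 'a)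
     \<Rightarrow> real \<Rightarrow> bool" where
  "G_Lipschitz M W F gh G \<longleftrightarrow>
     (\<forall>x\<in>W. \<forall>v\<in>subdifferential F x. norm v \<le> G) \<and>
     (\<forall>t\<ge>1. \<forall>x\<in>W. AE \<omega> in M. norm (gh t \<omega> x) \<le> G)"

text \<open>Only the values of the process at the times 1 to T are constrained.\<close>

definition sgd_iterates ::
  "'w measure \<Rightarrow> 'a::euclidean_space set \<Rightarrow> (nat \<Rightarrow> 'w \<Rightarrow> 'a \<Rightarrow> 'a) \<Rightarrow> (nat \<Rightarrow> real)
     \<Rightarrow> 'a \<Rightarrow> nat \<Rightarrow> (nat \<Rightarrow> 'w \<Rightarrow> 'a) \<Rightarrow> bool" where
  "sgd_iterates M W gh \<alpha> x1 T x \<longleftrightarrow>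
     (\<forall>\<omega>\<in>space M. x 1 \<omega> = x1 \<and>
        (\<forall>t\<in>{1..<T}.
           x (Suc t) \<omega> = closest_point W (x t \<omega> - \<alpha> t *\<^sub>R gh t \<omega> (x t \<omega>))))"

definition decreasing_steps :: "(nat \<Rightarrow> real) \<Rightarrow> bool" where
  "decreasing_steps \<gamma> \<longleftrightarrow> (\<forall>t\<ge>1. \<gamma> t \<ge> 0 \<and> \<gamma> (t + 1) \<le> \<gamma> t)"

definition polynomial_decay :: "real \<Rightarrow> (nat \<Rightarrow> real) \<Rightarrow> bool" where
  "polynomial_decay \<beta> \<gamma> \<longleftrightarrow> 0 < \<beta> \<and> \<beta> \<le> 1 \<and> (\<forall>t\<ge>1. \<gamma> (2 * t) \<ge> \<beta> * \<gamma> t)"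

definition num_phases :: "nat \<Rightarrow> nat" where
  "num_phases T = Inf {i. real T / 2 ^ i \<le> 1}"

definition phase_time :: "nat \<Rightarrow> nat \<Rightarrow> nat" where
  "phase_time T i = (if i \<le> num_phases T then T - nat \<lceil>real T / 2 ^ i\<rceil> else T)"

text \<open>
  The half-open intervals below partition the times 1 to T, so the modified step sizes are
  determined exactly at these times.
\<close>

definition step_modification :: "nat \<Rightarrow> (nat \<Rightarrow> real) \<Rightarrow> (nat \<Rightarrow> real) \<Rightarrow> bool" where
  "step_modification T \<gamma> \<alpha> \<longleftrightarrow>
     (\<forall>i\<le>num_phases T. \<forall>t. phase_time T i < t \<and> t \<le> phase_time T (i + 1)
        \<longrightarrow> \<alpha> t = \<gamma> t / 2 ^ i)"

end

theory Submission
  imports Defs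
begin

text \<open>
  Write \<open>e t\<close> for the expected value of \<open>F\<close> at the iterate \<open>x t\<close>. The argument rests on one
  inequality: an SGD run may be compared with any of its own earlier iterates \<open>x a\<close>. Expanding the
  square of the distance to \<open>x a\<close> after one step and using that the projection is nonexpansive gives
  \<open>(\<Sum>t=a..b. 2 * \<alpha> t * (e t - e a)) \<le> G\<^sup>2 * (\<Sum>t=a..b. (\<alpha> t)\<^sup>2)\<close>, because the initial distance is 0
  (\<open>expected_regret_earlier_iterate\<close>). The only probabilistic ingredient is that the oracle stays
  unbiased and bounded at the random point \<open>x t\<close>: the iterates up to time \<open>t\<close> depend on the noise
  before time \<open>t\<close> only, so Fubini's theorem allows to freeze them while averaging over the noise
  of time \<open>t\<close> (\<open>oracle_inner_product\<close>).

  The phases have halving lengths. Let \<open>a\<close> be the best time of one phase. Up to the end of that phase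
  the terms of the regret sum are nonnegative, so the sum over the next phase alone obeys
  the bound, and the best time of the next phase is worse than \<open>a\<close> by at most \<open>G\<^sup>2\<close> times the sum
  of squared step sizes divided by twice the sum of step sizes of the next phase
  (\<open>minimum_over_next_block\<close>). As consecutive phases have comparable length and the step sizes carry
  the factor \<open>1 / 2 ^ i\<close>, this loss is of order \<open>G\<^sup>2 * \<gamma> T / 2 ^ i\<close>, and the losses form a geometric
  series. The last phase is \<open>{T}\<close>, so the chain of best times ends at \<open>T\<close>. It may start at
  any best time \<open>a\<close> of the part of phase 0 after \<open>T / 4\<close>, where both runs still coincide; this is the
  infimum of the claim. Up to the factor \<open>\<beta>\<^sup>2\<close> there and \<open>\<beta>\<close> in later phases, the step sizes
  \<open>\<gamma> t\<close> are comparable to \<open>\<gamma> T\<close>. The losses add up to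
  \<open>G\<^sup>2 * \<gamma> T * (2 / \<beta> ^ 4 + 7 / (2 * \<beta>\<^sup>2))\<close> (\<open>modified_steps_last_value\<close>).

  When \<open>\<gamma> T = 0\<close> nothing can be divided by the sum of step sizes, but then all steps after \<open>T / 4\<close>
  vanish and the run stands still.
\<close>

section \<open>Freezing independent noise\<close>

text \<open>
  Independence of two sub-sigma-algebras, not only of random variables, is a statement about the
  identity map seen as two random elements: its doubling has a product law. All that is
  needed from Fubini's theorem follows from this.
\<close>

lemma (in prob_space) distr_diagonal_indep:
  assumes A: "subalgebra M A" and B: "subalgebra M B" and ind: "indep_set (sets B) (sets A)"
  shows "distr M B (\<lambda>\<omega>. \<omega>) \<Otimes>\<^sub>M distr M A (\<lambda>\<omega>. \<omega>) = distr M (B \<Otimes>\<^sub>M A) (\<lambda>\<omega>. (\<omega>, \<omega>))"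
proof -
  have preimages: "sigma_sets (space M) {(\<lambda>\<omega>. \<omega>) -` S \<inter> space M |S. S \<in> sets C} = sets C"
    if "subalgebra M C" for C
  proof -
    have "(\<lambda>\<omega>. \<omega>) -` S \<inter> space M = S" if "S \<in> sets C" for S
      using sets.sets_into_space[OF that] \<open>subalgebra M C\<close> by (auto simp: subalgebra_def)
    then have "{(\<lambda>\<omega>. \<omega>) -` S \<inter> space M |S. S \<in> sets C} = sets C"
      by (auto simp: Setcompr_eq_image)
    then show ?thesis
      using sets.sigma_sets_eq[of C] that by (simp add: subalgebra_def)
  qed
  have "(\<lambda>\<omega>. \<omega>) \<in> measurable M C" if "subalgebra M C" for C
    using measurable_from_subalg[OF that measurable_ident_sets[OF refl, of C]] .
  then have "indep_var B (\<lambda>\<omega>. \<omega>) A (\<lambda>\<omega>. \<omega>)"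
    unfolding indep_var_eq preimages[OF A] preimages[OF B] using A B ind by blast
  then show ?thesis
    by (simp add: indep_var_distribution_eq)
qed

lemma (in prob_space) AE_indep_pair:
  assumes A: "subalgebra M A" and B: "subalgebra M B" and ind: "indep_set (sets B) (sets A)"
    and P: "Measurable.pred (B \<Otimes>\<^sub>M A) P"
    and ae: "\<And>\<omega>'. \<omega>' \<in> space M \<Longrightarrow> AE \<omega> in M. P (\<omega>', \<omega>)"
  shows "AE \<omega> in M. P (\<omega>, \<omega>)"
proof -
  have id [measurable]: "(\<lambda>\<omega>. \<omega>) \<in> measurable M A" "(\<lambda>\<omega>. \<omega>) \<in> measurable M B"
    using measurable_from_subalg[OF A measurable_ident_sets[OF refl]]
      measurable_from_subalg[OF B measurable_ident_sets[OF refl]] by auto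
  interpret A': prob_space "distr M A (\<lambda>\<omega>. \<omega>)" by (rule prob_space_distr) simp
  interpret B': prob_space "distr M B (\<lambda>\<omega>. \<omega>)" by (rule prob_space_distr) simp
  interpret BA: pair_sigma_finite "distr M B (\<lambda>\<omega>. \<omega>)" "distr M A (\<lambda>\<omega>. \<omega>)" ..
  have [measurable]: "Measurable.pred A (\<lambda>\<omega>. P (\<omega>', \<omega>))" if "\<omega>' \<in> space B" for \<omega>'
    using measurable_compose[OF measurable_Pair1'[OF that] P] by simp
  have spB: "space B = space M"
    using B by (simp add: subalgebra_def)
  have "AE p in distr M B (\<lambda>\<omega>. \<omega>) \<Otimes>\<^sub>M distr M A (\<lambda>\<omega>. \<omega>). P p"
  proof (rule BA.AE_pair_measure)
    show "{p \<in> space (distr M B (\<lambda>\<omega>. \<omega>) \<Otimes>\<^sub>M distr M A (\<lambda>\<omega>. \<omega>)). P p}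
        \<in> sets (distr M B (\<lambda>\<omega>. \<omega>) \<Otimes>\<^sub>M distr M A (\<lambda>\<omega>. \<omega>))"
      using P by (simp add: pred_def space_pair_measure cong: sets_pair_measure_cong)
    show "AE \<omega>' in distr M B (\<lambda>\<omega>. \<omega>). AE \<omega> in distr M A (\<lambda>\<omega>. \<omega>). P (\<omega>', \<omega>)"
    proof (rule AE_I2)
      fix \<omega>' assume "\<omega>' \<in> space (distr M B (\<lambda>\<omega>. \<omega>))"
      then have w: "\<omega>' \<in> space B" by simp
      show "AE \<omega> in distr M A (\<lambda>\<omega>. \<omega>). P (\<omega>', \<omega>)"
        using ae[of \<omega>'] w spB by (subst AE_distr_iff) (auto simp: pred_def[symmetric])
    qed
  qed
  then show ?thesis
    unfolding distr_diagonal_indep[OF A B ind]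
    using P by (subst (asm) AE_distr_iff) (auto simp: pred_def)
qed

text \<open>
  Integrability with respect to the product measure, as Fubini's theorem requires it, is read off
  the diagonal, whose law is that product.
\<close>

lemma (in prob_space) integral_indep_pair:
  fixes f :: "'a \<times> 'a \<Rightarrow> real"
  assumes A: "subalgebra M A" and B: "subalgebra M B" and ind: "indep_set (sets B) (sets A)"
    and f: "f \<in> borel_measurable (B \<Otimes>\<^sub>M A)"
    and int: "integrable M (\<lambda>\<omega>. f (\<omega>, \<omega>))"
  shows "integrable M (\<lambda>\<omega>'. \<integral>\<omega>. f (\<omega>', \<omega>) \<partial>M)"
    and "(\<integral>\<omega>'. (\<integral>\<omega>. f (\<omega>', \<omega>) \<partial>M) \<partial>M) = (\<integral>\<omega>. f (\<omega>, \<omega>) \<partial>M)"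
proof -
  have id [measurable]: "(\<lambda>\<omega>. \<omega>) \<in> measurable M A" "(\<lambda>\<omega>. \<omega>) \<in> measurable M B"
    using measurable_from_subalg[OF A measurable_ident_sets[OF refl]]
      measurable_from_subalg[OF B measurable_ident_sets[OF refl]] by auto
  let ?A = "distr M A (\<lambda>\<omega>. \<omega>)" and ?B = "distr M B (\<lambda>\<omega>. \<omega>)"
  interpret A': prob_space ?A by (rule prob_space_distr) simp
  interpret B': prob_space ?B by (rule prob_space_distr) simp
  interpret BA: pair_sigma_finite ?B ?A ..
  note diag = distr_diagonal_indep[OF A B ind]
  have spB: "space B = space M"
    using B by (simp add: subalgebra_def)
  have inner: "(\<integral>\<omega>. f (\<omega>', \<omega>) \<partial>?A) = (\<integral>\<omega>. f (\<omega>', \<omega>) \<partial>M)" if "\<omega>' \<in> space M" for \<omega>'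
    using measurable_compose[OF measurable_Pair1' f, of \<omega>'] that spB
    by (subst integral_distr) auto
  have fBA: "integrable (?B \<Otimes>\<^sub>M ?A) f"
    unfolding diag using int f by (subst integrable_distr_eq) auto
  have "integrable ?B (\<lambda>\<omega>'. \<integral>\<omega>. f (\<omega>', \<omega>) \<partial>?A)"
    using BA.integrable_fst[of "\<lambda>\<omega>' \<omega>. f (\<omega>', \<omega>)"] fBA by simp
  note iB = this
  then have "integrable M (\<lambda>\<omega>'. \<integral>\<omega>. f (\<omega>', \<omega>) \<partial>?A)"
    using integrable_distr[OF id(2)] by blast
  then show "integrable M (\<lambda>\<omega>'. \<integral>\<omega>. f (\<omega>', \<omega>) \<partial>M)"
    by (simp add: inner cong: Bochner_Integration.integrable_cong)
  have "(\<integral>\<omega>'. (\<integral>\<omega>. f (\<omega>', \<omega>) \<partial>M) \<partial>M) = (\<integral>\<omega>'. (\<integral>\<omega>. f (\<omega>', \<omega>) \<partial>?A) \<partial>M)"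
    by (rule Bochner_Integration.integral_cong[OF refl]) (simp add: inner)
  also have "\<dots> = (\<integral>\<omega>'. (\<integral>\<omega>. f (\<omega>', \<omega>) \<partial>?A) \<partial>?B)"
    using borel_measurable_integrable[OF iB] by (subst integral_distr) auto
  also have "\<dots> = integral\<^sup>L (?B \<Otimes>\<^sub>M ?A) f"
    using BA.integral_fst[of "\<lambda>\<omega>' \<omega>. f (\<omega>', \<omega>)"] fBA by simp
  also have "\<dots> = (\<integral>\<omega>. f (\<omega>, \<omega>) \<partial>M)"
    unfolding diag using f by (subst integral_distr) auto
  finally show "(\<integral>\<omega>'. (\<integral>\<omega>. f (\<omega>', \<omega>) \<partial>M) \<partial>M) = (\<integral>\<omega>. f (\<omega>, \<omega>) \<partial>M)" .
qed

section \<open>The oracle and its past\<close>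

locale sgd_oracle = prob_space M
  for M :: "'w measure" +
  fixes W :: "'a::euclidean_space set"
    and F :: "'a \<Rightarrow> real"
    and g :: "nat \<Rightarrow> 'a \<Rightarrow> 'a"
    and gh :: "nat \<Rightarrow> 'w \<Rightarrow> 'a \<Rightarrow> 'a"
    and G :: real
    and A :: "nat \<Rightarrow> 'w measure"
  assumes closed_W: "closed W" and convex_W: "convex W"
    and convex_F: "convex_on UNIV F"
    and subalgebra_A: "t \<ge> 1 \<Longrightarrow> subalgebra M (A t)"
    and indep_A: "indep_sets (\<lambda>t. sets (A t)) {1..}"
    and measurable_gh:
      "t \<ge> 1 \<Longrightarrow> (\<lambda>(\<omega>, z). gh t \<omega> z) \<in> borel_measurable (A t \<Otimes>\<^sub>M restrict_space borel W)"
    and unbiased: "t \<ge> 1 \<Longrightarrow> z \<in> W \<Longrightarrow> has_bochner_integral M (\<lambda>\<omega>. gh t \<omega> z) (g t z)"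
    and subgradient: "t \<ge> 1 \<Longrightarrow> z \<in> W \<Longrightarrow> g t z \<in> subdifferential F z"
    and gradient_bound: "t \<ge> 1 \<Longrightarrow> z \<in> W \<Longrightarrow> AE \<omega> in M. norm (gh t \<omega> z) \<le> G"
begin

text \<open>The information revealed by the noise before time \<open>t\<close>, which determines the iterate \<open>x t\<close>.\<close>

definition past :: "nat \<Rightarrow> 'w measure" where
  "past t = sigma (space M) (\<Union>s\<in>{1..<t}. sets (A s))"

lemma past_subsets: "(\<Union>s\<in>{1..<t}. sets (A s)) \<subseteq> Pow (space M)"
proof -
  have "sets (A s) \<subseteq> Pow (space M)" if "s \<ge> 1" for s
    using sets.space_closed[of "A s"] subalgebra_A[OF that] by (simp add: subalgebra_def)
  then show ?thesis by fastforce
qed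

lemma space_past [simp]: "space (past t) = space M"
  by (simp add: past_def space_measure_of_conv)

lemma sets_past: "sets (past t) = sigma_sets (space M) (\<Union>s\<in>{1..<t}. sets (A s))"
  using past_subsets by (simp add: past_def sets_measure_of)

lemma subalgebra_past: "subalgebra M (past t)"
proof -
  have "sets (A s) \<subseteq> sets M" if "s \<ge> 1" for s
    using subalgebra_A[OF that] by (simp add: subalgebra_def)
  then have "(\<Union>s\<in>{1..<t}. sets (A s)) \<subseteq> sets M" by fastforce
  then show ?thesis
    by (simp add: subalgebra_def sets_past sets.sigma_sets_subset)
qed

lemma subalgebra_past_mono: "s \<le> t \<Longrightarrow> subalgebra (past t) (past s)"
  unfolding subalgebra_def sets_past space_past
  by (intro conjI refl sigma_sets_mono' UN_mono) auto

lemma subalgebra_A_past: "1 \<le> s \<Longrightarrow> s < t \<Longrightarrow> subalgebra (past t) (A s)"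
  using subalgebra_A[of s] unfolding subalgebra_def sets_past by (auto intro!: sigma_sets.Basic)

text \<open>
  Grouping an independent family along a partition of its index set preserves independence; here
  the groups are the times before \<open>t\<close> and \<open>t\<close> itself.
\<close>

lemma indep_past:
  assumes "t \<ge> 1"
  shows "indep_set (sets (past t)) (sets (A t))"
proof -
  let ?I = "case_bool {1..<t} {t}"
  have "indep_sets (\<lambda>b. sigma_sets (space M) (\<Union>s\<in>?I b. sets (A s))) UNIV"
  proof (rule indep_sets_collect_sigma)
    show "indep_sets (\<lambda>s. sets (A s)) (\<Union>b\<in>UNIV. ?I b)"
      by (rule indep_sets_mono_index[OF _ indep_A]) (use assms in \<open>auto split: bool.splits\<close>)
    show "disjoint_family_on ?I UNIV"
      by (auto simp: disjoint_family_on_def split: bool.splits)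
  qed (rule sets.Int_stable)
  moreover have "sigma_sets (space M) (sets (A t)) = sets (A t)"
    using sets.sigma_sets_eq[of "A t"] subalgebra_A[OF assms] by (simp add: subalgebra_def)
  then have "(\<lambda>b. sigma_sets (space M) (\<Union>s\<in>?I b. sets (A s))) = case_bool (sets (past t)) (sets (A t))"
    by (auto simp: sets_past fun_eq_iff split: bool.splits)
  ultimately show ?thesis
    by (simp add: indep_set_def)
qed

lemma measurable_oracle_at:
  assumes t: "t \<ge> 1" and u: "u \<in> measurable (past t) (restrict_space borel W)"
  shows "(\<lambda>(\<omega>', \<omega>). gh t \<omega> (u \<omega>')) \<in> borel_measurable (past t \<Otimes>\<^sub>M A t)"
proof -
  have "(\<lambda>p. (snd p, u (fst p))) \<in> measurable (past t \<Otimes>\<^sub>M A t) (A t \<Otimes>\<^sub>M restrict_space borel W)"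
    using u by measurable
  from measurable_compose[OF this measurable_gh[OF t]] show ?thesis
    by (simp add: case_prod_beta)
qed

lemma past_in_W:
  "u \<in> measurable (past t) (restrict_space borel W) \<Longrightarrow> \<omega> \<in> space M \<Longrightarrow> u \<omega> \<in> W"
  using measurable_space[of u "past t" "restrict_space borel W" \<omega>] by (simp add: space_restrict_space)

lemma borel_past:
  "u \<in> measurable (past t) (restrict_space borel W) \<Longrightarrow> u \<in> borel_measurable (past t)"
  by (simp add: measurable_restrict_space2_iff)

lemma borel_past_M:
  "u \<in> measurable (past t) (restrict_space borel W) \<Longrightarrow> u \<in> borel_measurable M"
  using measurable_from_subalg[OF subalgebra_past borel_past] .

text \<open>
  The exceptional null set of the bound \<open>G\<close> depends on the argument of the oracle, so the bound at
  a random argument needs independence.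
\<close>

lemma AE_gradient_bound_at:
  assumes t: "t \<ge> 1" and u: "u \<in> measurable (past t) (restrict_space borel W)"
  shows "AE \<omega> in M. norm (gh t \<omega> (u \<omega>)) \<le> G"
proof -
  have "AE \<omega> in M. (\<lambda>(\<omega>', \<omega>). norm (gh t \<omega> (u \<omega>')) \<le> G) (\<omega>, \<omega>)"
  proof (rule AE_indep_pair[OF subalgebra_A[OF t] subalgebra_past indep_past[OF t]])
    note measurable_oracle_at[OF assms, measurable]
    have "Measurable.pred (past t \<Otimes>\<^sub>M A t) (\<lambda>p. norm ((\<lambda>(\<omega>', \<omega>). gh t \<omega> (u \<omega>')) p) \<le> G)"
      by measurable
    then show "Measurable.pred (past t \<Otimes>\<^sub>M A t) (\<lambda>(\<omega>', \<omega>). norm (gh t \<omega> (u \<omega>')) \<le> G)"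
      by (simp add: case_prod_beta)
  qed (use gradient_bound[OF t] past_in_W[OF u] in auto)
  then show ?thesis by simp
qed

lemma borel_measurable_F: "F \<in> borel_measurable borel"
  using convex_on_continuous[OF open_UNIV convex_F] by (rule borel_measurable_continuous_onI)

text \<open>
  A finite convex function on the whole space is continuous, hence bounded on balls.
\<close>

lemma integrable_F:
  assumes u: "u \<in> borel_measurable M" and R: "AE \<omega> in M. norm (u \<omega>) \<le> R"
  shows "integrable M (\<lambda>\<omega>. F (u \<omega>))"
proof -
  have "compact (F ` cball 0 R)"
    using convex_on_continuous[OF open_UNIV convex_F]
    by (intro compact_continuous_image) (auto intro: continuous_on_subset)
  then obtain K where "\<And>z. z \<in> cball 0 R \<Longrightarrow> norm (F z) \<le> K"
    by (meson bounded_iff compact_imp_bounded imageI)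
  then have "AE \<omega> in M. norm (F (u \<omega>)) \<le> K"
    using R by (auto elim!: eventually_mono)
  then show ?thesis
    using measurable_compose[OF u borel_measurable_F] by (rule integrable_const_bound)
qed

text \<open>
  Averaging over the noise of time \<open>t\<close> with \<open>u\<close> and \<open>v\<close> frozen turns the random direction into a
  subgradient at \<open>u\<close>, for which convexity gives the comparison of function values.
\<close>

lemma oracle_inner_product:
  assumes t: "t \<ge> 1"
    and u: "u \<in> measurable (past t) (restrict_space borel W)" "AE \<omega> in M. norm (u \<omega>) \<le> R"
    and v: "v \<in> measurable (past t) (restrict_space borel W)" "AE \<omega> in M. norm (v \<omega>) \<le> S"
  shows integrable_oracle_inner: "integrable M (\<lambda>\<omega>. gh t \<omega> (u \<omega>) \<bullet> (u \<omega> - v \<omega>))"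
    and expected_gap_le_oracle_inner:
      "(\<integral>\<omega>. F (u \<omega>) \<partial>M) - (\<integral>\<omega>. F (v \<omega>) \<partial>M) \<le> (\<integral>\<omega>. gh t \<omega> (u \<omega>) \<bullet> (u \<omega> - v \<omega>) \<partial>M)"
proof -
  let ?f = "\<lambda>(\<omega>', \<omega>). gh t \<omega> (u \<omega>') \<bullet> (u \<omega>' - v \<omega>')"
  note [measurable] = borel_past[OF u(1)] borel_past[OF v(1)] borel_past_M[OF u(1)]
    borel_past_M[OF v(1)] measurable_oracle_at[OF t u(1)]
  have "(\<lambda>p. (\<lambda>(\<omega>', \<omega>). gh t \<omega> (u \<omega>')) p \<bullet> (u (fst p) - v (fst p)))
      \<in> borel_measurable (past t \<Otimes>\<^sub>M A t)"
    by measurable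
  then have f: "?f \<in> borel_measurable (past t \<Otimes>\<^sub>M A t)"
    by (simp add: case_prod_beta)
  have "(\<lambda>\<omega>. (\<omega>, \<omega>)) \<in> measurable M (past t \<Otimes>\<^sub>M A t)"
    using measurable_from_subalg[OF subalgebra_past measurable_ident_sets[OF refl]]
      measurable_from_subalg[OF subalgebra_A[OF t] measurable_ident_sets[OF refl]]
    by (rule measurable_Pair)
  then have meas: "(\<lambda>\<omega>. ?f (\<omega>, \<omega>)) \<in> borel_measurable M"
    using f by (rule measurable_compose)
  have "AE \<omega> in M. norm (?f (\<omega>, \<omega>)) \<le> G * (R + S)"
    using AE_gradient_bound_at[OF t u(1)] u(2) v(2)
  proof eventually_elim
    case (elim \<omega>)
    have "norm (?f (\<omega>, \<omega>)) \<le> norm (gh t \<omega> (u \<omega>)) * norm (u \<omega> - v \<omega>)"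
      by (simp add: Cauchy_Schwarz_ineq2)
    also have "\<dots> \<le> G * (R + S)"
      using elim norm_triangle_ineq4[of "u \<omega>" "v \<omega>"] norm_ge_zero[of "gh t \<omega> (u \<omega>)"]
      by (intro mult_mono) (linarith, linarith, linarith, simp)
    finally show ?case .
  qed
  then have int: "integrable M (\<lambda>\<omega>. ?f (\<omega>, \<omega>))"
    using meas by (rule integrable_const_bound)
  then show "integrable M (\<lambda>\<omega>. gh t \<omega> (u \<omega>) \<bullet> (u \<omega> - v \<omega>))"
    by simp
  note pair = integral_indep_pair[OF subalgebra_A[OF t] subalgebra_past indep_past[OF t] f int]
  have inner: "F (u \<omega>') - F (v \<omega>') \<le> (\<integral>\<omega>. ?f (\<omega>', \<omega>) \<partial>M)" if "\<omega>' \<in> space M" for \<omega>'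
  proof -
    have uW: "u \<omega>' \<in> W"
      using past_in_W[OF u(1) that] .
    have "(\<integral>\<omega>. ?f (\<omega>', \<omega>) \<partial>M) = g t (u \<omega>') \<bullet> (u \<omega>' - v \<omega>')"
      using has_bochner_integral_inner_left[OF unbiased[OF t uW]]
      by (auto simp: has_bochner_integral_iff)
    moreover have "F (v \<omega>') \<ge> F (u \<omega>') + g t (u \<omega>') \<bullet> (v \<omega>' - u \<omega>')"
      using subgradient[OF t uW] by (simp add: subdifferential_def)
    ultimately show ?thesis
      by (simp add: inner_diff_right)
  qed
  have Fu: "integrable M (\<lambda>\<omega>. F (u \<omega>))" "integrable M (\<lambda>\<omega>. F (v \<omega>))"
    using integrable_F[OF _ u(2)] integrable_F[OF _ v(2)] by simp_all
  have "(\<integral>\<omega>. F (u \<omega>) \<partial>M) - (\<integral>\<omega>. F (v \<omega>) \<partial>M) = (\<integral>\<omega>. F (u \<omega>) - F (v \<omega>) \<partial>M)"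
    using Fu by simp
  also have "\<dots> \<le> (\<integral>\<omega>'. (\<integral>\<omega>. ?f (\<omega>', \<omega>) \<partial>M) \<partial>M)"
    using Fu pair(1) inner by (intro integral_mono) auto
  also have "\<dots> = (\<integral>\<omega>. gh t \<omega> (u \<omega>) \<bullet> (u \<omega> - v \<omega>) \<partial>M)"
    using pair(2) by simp
  finally show "(\<integral>\<omega>. F (u \<omega>) \<partial>M) - (\<integral>\<omega>. F (v \<omega>) \<partial>M) \<le> (\<integral>\<omega>. gh t \<omega> (u \<omega>) \<bullet> (u \<omega> - v \<omega>) \<partial>M)" .
qed

section \<open>Comparing a run with its own earlier iterates\<close>

lemma iterate_measurable:
  assumes x: "sgd_iterates M W gh \<alpha> x1 N x" and x1: "x1 \<in> W" and t: "1 \<le> t" "t \<le> N"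
  shows "x t \<in> measurable (past t) (restrict_space borel W)"
  using t
proof (induction t rule: nat_induct_at_least)
  case base
  have "(\<lambda>\<omega>. x1) \<in> measurable (past 1) (restrict_space borel W)"
    using x1 by (simp add: space_restrict_space)
  then show ?case
    using x by (subst measurable_cong[where g = "\<lambda>\<omega>. x1"]) (auto simp: sgd_iterates_def)
next
  case (Suc t)
  then have xt: "x t \<in> measurable (past t) (restrict_space borel W)" by simp
  have step: "x (Suc t) \<omega> = closest_point W (x t \<omega> - \<alpha> t *\<^sub>R gh t \<omega> (x t \<omega>))" if "\<omega> \<in> space M" for \<omega>
    using x Suc that by (auto simp: sgd_iterates_def)
  have "(\<lambda>\<omega>. (\<omega>, x t \<omega>)) \<in> measurable (past (Suc t)) (A t \<Otimes>\<^sub>M restrict_space borel W)"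
    using Suc measurable_from_subalg[OF subalgebra_A_past measurable_ident_sets[OF refl], of t "Suc t"]
      measurable_from_subalg[OF subalgebra_past_mono xt, of "Suc t"]
    by (intro measurable_Pair) auto
  from measurable_compose[OF this measurable_gh]
  have [measurable]: "(\<lambda>\<omega>. gh t \<omega> (x t \<omega>)) \<in> borel_measurable (past (Suc t))"
    using Suc by simp
  have [measurable]: "x t \<in> borel_measurable (past (Suc t))"
    using measurable_from_subalg[OF subalgebra_past_mono borel_past[OF xt], of "Suc t"] by simp
  have [measurable]: "closest_point W \<in> borel_measurable borel"
    using x1 closed_W convex_W by (intro borel_measurable_continuous_onI continuous_on_closest_point) auto
  have "(\<lambda>\<omega>. closest_point W (x t \<omega> - \<alpha> t *\<^sub>R gh t \<omega> (x t \<omega>)))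
      \<in> measurable (past (Suc t)) (restrict_space borel W)"
    using x1 closed_W by (intro measurable_restrict_space2) (auto intro: closest_point_in_set)
  then show ?case
    using step by (subst measurable_cong) auto
qed

text \<open>
  Each step moves by at most \<open>\<bar>\<alpha> t\<bar> * G\<close> almost surely, so every iterate is bounded; this is
  where all integrability comes from.
\<close>

lemma iterate_bounded:
  assumes x: "sgd_iterates M W gh \<alpha> x1 N x" and x1: "x1 \<in> W" and t: "1 \<le> t" "t \<le> N"
  shows "\<exists>R. AE \<omega> in M. norm (x t \<omega>) \<le> R"
  using t
proof (induction t rule: nat_induct_at_least)
  case base
  have "AE \<omega> in M. norm (x 1 \<omega>) \<le> norm x1"
    using x by (intro AE_I2) (auto simp: sgd_iterates_def)
  then show ?case by blast
next
  case (Suc t)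
  then obtain R where R: "AE \<omega> in M. norm (x t \<omega>) \<le> R" by auto
  have xt: "x t \<in> measurable (past t) (restrict_space borel W)"
    using iterate_measurable[OF x x1] Suc by simp
  have "AE \<omega> in M. norm (x (Suc t) \<omega>) \<le> R + \<bar>\<alpha> t\<bar> * G"
    using R AE_gradient_bound_at[OF \<open>1 \<le> t\<close> xt] AE_space
  proof eventually_elim
    case (elim \<omega>)
    have "dist (x (Suc t) \<omega>) (x t \<omega>)
        = dist (closest_point W (x t \<omega> - \<alpha> t *\<^sub>R gh t \<omega> (x t \<omega>))) (closest_point W (x t \<omega>))"
      using x Suc elim past_in_W[OF xt] by (auto simp: sgd_iterates_def closest_point_self)
    also have "\<dots> \<le> dist (x t \<omega> - \<alpha> t *\<^sub>R gh t \<omega> (x t \<omega>)) (x t \<omega>)"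
      using x1 closed_W convex_W by (intro closest_point_lipschitz) auto
    also have "\<dots> = \<bar>\<alpha> t\<bar> * norm (gh t \<omega> (x t \<omega>))"
      by (simp add: dist_norm)
    also have "\<dots> \<le> \<bar>\<alpha> t\<bar> * G"
      using elim by (intro mult_left_mono) auto
    finally show ?case
      using elim norm_triangle_ineq2[of "x (Suc t) \<omega>" "x t \<omega>"] by (simp add: dist_norm)
  qed
  then show ?case by blast
qed

text \<open>
  The point \<open>x a\<close> lies in \<open>W\<close>, so it is its own projection, and projecting can only bring the
  new iterate closer to it. The cross term of the expanded square is the inner product whose
  expectation dominates the gap in function value.
\<close>

lemma expected_distance_step:
  assumes x: "sgd_iterates M W gh \<alpha> x1 N x" and x1: "x1 \<in> W"
    and a: "1 \<le> a" "a \<le> t" "t < N" and pos: "\<alpha> t \<ge> 0"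
  shows "(\<integral>\<omega>. (norm (x (Suc t) \<omega> - x a \<omega>))\<^sup>2 \<partial>M)
        + 2 * \<alpha> t * ((\<integral>\<omega>. F (x t \<omega>) \<partial>M) - (\<integral>\<omega>. F (x a \<omega>) \<partial>M))
      \<le> (\<integral>\<omega>. (norm (x t \<omega> - x a \<omega>))\<^sup>2 \<partial>M) + G\<^sup>2 * (\<alpha> t)\<^sup>2"
proof -
  have xt: "x t \<in> measurable (past t) (restrict_space borel W)"
    using iterate_measurable[OF x x1] a by simp
  have xa: "x a \<in> measurable (past t) (restrict_space borel W)"
    using measurable_from_subalg[OF subalgebra_past_mono iterate_measurable[OF x x1], of a t] a by simp
  have sq: "integrable M (\<lambda>\<omega>. (norm (x s \<omega> - x a \<omega>))\<^sup>2)" if s: "1 \<le> s" "s \<le> N" for s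
  proof -
    have [measurable]: "x s \<in> borel_measurable M" "x a \<in> borel_measurable M"
      using borel_past_M[OF iterate_measurable[OF x x1]] s a by auto
    obtain R S where "AE \<omega> in M. norm (x s \<omega>) \<le> R" "AE \<omega> in M. norm (x a \<omega>) \<le> S"
      using iterate_bounded[OF x x1] s a by (metis less_imp_le order_trans)
    then have "AE \<omega> in M. norm ((norm (x s \<omega> - x a \<omega>))\<^sup>2) \<le> (R + S)\<^sup>2"
    proof eventually_elim
      case (elim \<omega>)
      then have "norm (x s \<omega> - x a \<omega>) \<le> R + S"
        using norm_triangle_ineq4[of "x s \<omega>" "x a \<omega>"] by linarith
      then show ?case by (simp add: power_mono)
    qed
    then show ?thesis by (rule integrable_const_bound) measurable
  qed
  obtain R S where RS: "AE \<omega> in M. norm (x t \<omega>) \<le> R" "AE \<omega> in M. norm (x a \<omega>) \<le> S"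
    using iterate_bounded[OF x x1] a by (metis less_imp_le order_trans)
  have t1: "1 \<le> t" using a by simp
  note int = integrable_oracle_inner[OF t1 xt RS(1) xa RS(2)]
  note gap = expected_gap_le_oracle_inner[OF t1 xt RS(1) xa RS(2)]
  have "AE \<omega> in M. (norm (x (Suc t) \<omega> - x a \<omega>))\<^sup>2
      \<le> (norm (x t \<omega> - x a \<omega>))\<^sup>2 - 2 * \<alpha> t * (gh t \<omega> (x t \<omega>) \<bullet> (x t \<omega> - x a \<omega>)) + G\<^sup>2 * (\<alpha> t)\<^sup>2"
    using AE_gradient_bound_at[OF t1 xt] AE_space
  proof eventually_elim
    case (elim \<omega>)
    let ?h = "gh t \<omega> (x t \<omega>)"
    have "dist (x (Suc t) \<omega>) (x a \<omega>)
        = dist (closest_point W (x t \<omega> - \<alpha> t *\<^sub>R ?h)) (closest_point W (x a \<omega>))"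
      using x a elim past_in_W[OF xa] by (auto simp: sgd_iterates_def closest_point_self)
    also have "\<dots> \<le> dist (x t \<omega> - \<alpha> t *\<^sub>R ?h) (x a \<omega>)"
      using x1 closed_W convex_W by (intro closest_point_lipschitz) auto
    also have "\<dots> = norm ((x t \<omega> - x a \<omega>) - \<alpha> t *\<^sub>R ?h)"
      by (simp add: dist_norm algebra_simps)
    finally have "(norm (x (Suc t) \<omega> - x a \<omega>))\<^sup>2 \<le> (norm ((x t \<omega> - x a \<omega>) - \<alpha> t *\<^sub>R ?h))\<^sup>2"
      by (simp add: dist_norm power_mono)
    also have "\<dots> = (norm (x t \<omega> - x a \<omega>))\<^sup>2 - 2 * \<alpha> t * (?h \<bullet> (x t \<omega> - x a \<omega>))
        + (norm ?h)\<^sup>2 * (\<alpha> t)\<^sup>2"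
      unfolding power2_norm_eq_inner
      by (simp add: inner_diff_left inner_diff_right inner_commute power2_eq_square algebra_simps)
    also have "\<dots> \<le> (norm (x t \<omega> - x a \<omega>))\<^sup>2 - 2 * \<alpha> t * (?h \<bullet> (x t \<omega> - x a \<omega>)) + G\<^sup>2 * (\<alpha> t)\<^sup>2"
      using elim by (intro add_left_mono mult_right_mono power_mono) auto
    finally show ?case .
  qed
  then have "(\<integral>\<omega>. (norm (x (Suc t) \<omega> - x a \<omega>))\<^sup>2 \<partial>M)
      \<le> (\<integral>\<omega>. (norm (x t \<omega> - x a \<omega>))\<^sup>2 - 2 * \<alpha> t * (gh t \<omega> (x t \<omega>) \<bullet> (x t \<omega> - x a \<omega>))
          + G\<^sup>2 * (\<alpha> t)\<^sup>2 \<partial>M)"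
    using sq[of t] sq[of "Suc t"] int a by (intro integral_mono_AE) auto
  also have "\<dots> = (\<integral>\<omega>. (norm (x t \<omega> - x a \<omega>))\<^sup>2 \<partial>M)
      - 2 * \<alpha> t * (\<integral>\<omega>. gh t \<omega> (x t \<omega>) \<bullet> (x t \<omega> - x a \<omega>) \<partial>M) + G\<^sup>2 * (\<alpha> t)\<^sup>2"
    using sq[of t] int a by (simp add: prob_space)
  also have "\<dots> \<le> (\<integral>\<omega>. (norm (x t \<omega> - x a \<omega>))\<^sup>2 \<partial>M)
      - 2 * \<alpha> t * ((\<integral>\<omega>. F (x t \<omega>) \<partial>M) - (\<integral>\<omega>. F (x a \<omega>) \<partial>M)) + G\<^sup>2 * (\<alpha> t)\<^sup>2"
    using mult_left_mono[OF gap, of "2 * \<alpha> t"] pos by simp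
  finally show ?thesis by simp
qed

text \<open>
  Telescoping sum of the previous inequality, starting from distance 0 and dropping the final
  squared distance.
\<close>

lemma expected_regret_earlier_iterate:
  assumes x: "sgd_iterates M W gh \<alpha> x1 N x" and x1: "x1 \<in> W"
    and a: "1 \<le> a" and b: "a \<le> b" "b \<le> N"
    and pos: "\<And>t. a \<le> t \<Longrightarrow> t \<le> b \<Longrightarrow> \<alpha> t \<ge> 0"
  shows "(\<Sum>t=a..b. 2 * \<alpha> t * ((\<integral>\<omega>. F (x t \<omega>) \<partial>M) - (\<integral>\<omega>. F (x a \<omega>) \<partial>M)))
      \<le> G\<^sup>2 * (\<Sum>t=a..b. (\<alpha> t)\<^sup>2)"
proof -
  \<comment> \<open>The step leaving \<open>b\<close> may lie beyond the run, which is therefore continued once more.\<close>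
  let ?z = "x(Suc N := \<lambda>\<omega>. closest_point W (x N \<omega> - \<alpha> N *\<^sub>R gh N \<omega> (x N \<omega>)))"
  let ?e = "\<lambda>t. \<integral>\<omega>. F (x t \<omega>) \<partial>M"
  have z: "sgd_iterates M W gh \<alpha> x1 (Suc N) ?z"
    using x a b unfolding sgd_iterates_def by (auto simp: less_Suc_eq)
  have total: "(\<integral>\<omega>. (norm (?z (Suc m) \<omega> - ?z a \<omega>))\<^sup>2 \<partial>M) + (\<Sum>t=a..m. 2 * \<alpha> t * (?e t - ?e a))
      \<le> G\<^sup>2 * (\<Sum>t=a..m. (\<alpha> t)\<^sup>2)" if "a \<le> m" "m \<le> b" for m
    using that
  proof (induction m rule: nat_induct_at_least)
    case base
    then show ?case
      using expected_distance_step[OF z x1 a order_refl] pos[of a] b by simp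
  next
    case (Suc m)
    then show ?case
      using expected_distance_step[OF z x1 a, of "Suc m"] pos[of "Suc m"] b
      by (simp add: algebra_simps)
  qed
  moreover have "0 \<le> (\<integral>\<omega>. (norm (?z (Suc b) \<omega> - ?z a \<omega>))\<^sup>2 \<partial>M)"
    by (rule Bochner_Integration.integral_nonneg) simp
  ultimately show ?thesis
    using total[OF b(1) order_refl] by linarith
qed


text \<open>Iterates lie in \<open>W\<close>, where the projection is the identity.\<close>

lemma constant_without_steps:
  assumes x: "sgd_iterates M W gh \<alpha> x1 N x" and x1: "x1 \<in> W"
    and a: "1 \<le> a" and b: "a \<le> b" "b \<le> N"
    and zero: "\<And>t. a \<le> t \<Longrightarrow> t < b \<Longrightarrow> \<alpha> t = 0" and \<omega>: "\<omega> \<in> space M"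
  shows "x b \<omega> = x a \<omega>"
  using b zero
proof (induction b rule: dec_induct)
  case (step t)
  have "x t \<omega> \<in> W"
    using past_in_W[OF iterate_measurable[OF x x1] \<omega>] a step by simp
  moreover have "x (Suc t) \<omega> = closest_point W (x t \<omega> - \<alpha> t *\<^sub>R gh t \<omega> (x t \<omega>))"
    using x \<omega> a step by (auto simp: sgd_iterates_def)
  ultimately show ?case
    using step by (simp add: closest_point_self)
qed simp

end

lemma sgd_iterates_cong:
  assumes x: "sgd_iterates M W gh \<alpha> x1 N x" and y: "sgd_iterates M W gh \<gamma> x1 N y"
    and t: "1 \<le> t" "t \<le> N"
    and eq: "\<And>s. 1 \<le> s \<Longrightarrow> s < t \<Longrightarrow> \<alpha> s = \<gamma> s" and \<omega>: "\<omega> \<in> space M"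
  shows "x t \<omega> = y t \<omega>"
  using t eq
proof (induction t rule: nat_induct_at_least)
  case base
  then show ?case using x y \<omega> by (simp add: sgd_iterates_def)
next
  case (Suc t)
  then have "x t \<omega> = y t \<omega>" "\<alpha> t = \<gamma> t" by simp_all
  then show ?case using x y \<omega> Suc by (simp add: sgd_iterates_def)
qed

section \<open>Passing from one block of times to the next\<close>

text \<open>
  If \<open>a\<close> is optimal on \<open>{a..m}\<close>, the regret terms up to \<open>m\<close> are nonnegative and can be dropped on
  the left of the regret inequality, while all values on \<open>{m<..b}\<close> exceed \<open>e a\<close> by at least the
  excess of their minimum. The ratio \<open>R\<close> of the block lengths then cancels the lengths from the bound.
\<close>

lemma minimum_over_next_block:
  fixes e \<alpha> :: "nat \<Rightarrow> real"
  assumes regret: "(\<Sum>t=a..b. 2 * \<alpha> t * (e t - e a)) \<le> K * (\<Sum>t=a..b. (\<alpha> t)\<^sup>2)"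
    and order: "a \<le> m" "m < b"
    and first: "\<And>t. a \<le> t \<Longrightarrow> t \<le> m \<Longrightarrow> 0 \<le> \<alpha> t \<and> \<alpha> t \<le> A"
    and second: "\<And>t. m < t \<Longrightarrow> t \<le> b \<Longrightarrow> L \<le> \<alpha> t \<and> \<alpha> t \<le> B"
    and a_min: "\<And>t. a \<le> t \<Longrightarrow> t \<le> m \<Longrightarrow> e a \<le> e t"
    and ratio: "real (m + 1 - a) \<le> R * real (b - m)"
    and pos: "L > 0" "K \<ge> 0"
  shows "\<exists>c. m < c \<and> c \<le> b \<and> (\<forall>t. m < t \<and> t \<le> b \<longrightarrow> e c \<le> e t)
    \<and> e c \<le> e a + K * (R * A\<^sup>2 + B\<^sup>2) / (2 * L)"
proof -
  obtain c where c: "c \<in> {m<..b}" and c_min: "\<And>t. t \<in> {m<..b} \<Longrightarrow> e c \<le> e t"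
    using ex_min_if_finite[of "e ` {m<..b}"] order by (auto simp: not_less)
  let ?n = "real (b - m)"
  have n: "?n > 0" using order by simp
  have split: "(\<Sum>t=a..b. f t) = (\<Sum>t=a..m. f t) + (\<Sum>t\<in>{m<..b}. f t)" for f :: "nat \<Rightarrow> real"
  proof -
    have "{a..b} = {a..m} \<union> {m<..b}" using order by auto
    moreover have "{a..m} \<inter> {m<..b} = {}" by auto
    ultimately show ?thesis
      by (simp add: sum.union_disjoint)
  qed
  have "R * ?n > 0" using ratio order by (simp add: Suc_diff_le)
  then have "R > 0" using n by (simp add: zero_less_mult_iff)
  have "e c \<le> e a + K * (R * A\<^sup>2 + B\<^sup>2) / (2 * L)"
  proof (cases "e c \<le> e a")
    case True
    have "0 \<le> K * (R * A\<^sup>2 + B\<^sup>2) / (2 * L)"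
      using pos \<open>R > 0\<close> by simp
    with True show ?thesis by simp
  next
    case False
    let ?d = "e c - e a"
    have "2 * L * ?d * ?n = (\<Sum>t\<in>{m<..b}. 2 * L * ?d)"
      by simp
    also have "\<dots> \<le> (\<Sum>t\<in>{m<..b}. 2 * \<alpha> t * (e t - e a))"
    proof (rule sum_mono)
      fix t assume t: "t \<in> {m<..b}"
      have "2 * L \<le> 2 * \<alpha> t" "?d \<le> e t - e a" "0 \<le> ?d"
        using second[of t] c_min[OF t] False t by auto
      then show "2 * L * ?d \<le> 2 * \<alpha> t * (e t - e a)"
        using pos by (intro mult_mono) auto
    qed
    also have "\<dots> \<le> (\<Sum>t=a..b. 2 * \<alpha> t * (e t - e a))"
      unfolding split using first a_min by (auto intro!: sum_nonneg)
    also have "\<dots> \<le> K * (\<Sum>t=a..b. (\<alpha> t)\<^sup>2)"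
      by (rule regret)
    also have "\<dots> \<le> K * (\<Sum>t=a..m. A\<^sup>2) + K * (\<Sum>t\<in>{m<..b}. B\<^sup>2)"
      unfolding split distrib_left[symmetric] using first second pos
      by (intro mult_left_mono add_mono sum_mono power_mono) (auto intro: order_trans[OF less_imp_le])
    also have "\<dots> = K * (real (m + 1 - a) * A\<^sup>2 + ?n * B\<^sup>2)"
      by (simp add: algebra_simps)
    also have "\<dots> \<le> K * ((R * ?n) * A\<^sup>2 + ?n * B\<^sup>2)"
      using ratio pos by (intro mult_left_mono add_mono mult_right_mono) auto
    also have "\<dots> = K * (R * A\<^sup>2 + B\<^sup>2) * ?n"
      by (simp add: algebra_simps)
    finally have "2 * L * ?d \<le> K * (R * A\<^sup>2 + B\<^sup>2)"
      using n by simp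
    then show ?thesis
      using pos by (simp add: field_simps)
  qed
  with c c_min show ?thesis by (intro exI[of _ c]) auto
qed

section \<open>The phases\<close>

text \<open>
  Phase \<open>i\<close> starts after time \<open>T - remaining_steps T i\<close>. In these terms the recursion is a
  halving of natural numbers that rounds up, which linear arithmetic can handle.
\<close>

definition remaining_steps :: "nat \<Rightarrow> nat \<Rightarrow> nat" where
  "remaining_steps T i = nat \<lceil>real T / 2 ^ i\<rceil>"

lemma remaining_steps_0 [simp]: "remaining_steps T 0 = T"
  by (simp add: remaining_steps_def)

lemma remaining_steps_Suc: "remaining_steps T (Suc i) = (remaining_steps T i + 1) div 2"
proof -
  \<comment> \<open>Ceilings are compared through their upper bounds: \<open>\<lceil>r\<rceil> \<le> m\<close> means \<open>r \<le> m\<close>.\<close>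
  have "remaining_steps T (Suc i) \<le> m \<longleftrightarrow> (remaining_steps T i + 1) div 2 \<le> m" for m
  proof -
    have "remaining_steps T (Suc i) \<le> m \<longleftrightarrow> real T / 2 ^ i \<le> real (2 * m)"
      unfolding remaining_steps_def nat_ceiling_le_eq by (simp add: field_simps)
    also have "\<dots> \<longleftrightarrow> remaining_steps T i \<le> 2 * m"
      unfolding remaining_steps_def nat_ceiling_le_eq ..
    also have "\<dots> \<longleftrightarrow> (remaining_steps T i + 1) div 2 \<le> m"
      by linarith
    finally show ?thesis .
  qed
  then show ?thesis
    by (metis order_antisym order_refl)
qed

lemma remaining_steps_num_phases: "T \<ge> 1 \<Longrightarrow> remaining_steps T (num_phases T) = 1"
  and remaining_steps_before: "i < num_phases T \<Longrightarrow> remaining_steps T i \<ge> 2"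
proof -
  let ?S = "{i. real T / 2 ^ i \<le> 1}"
  have S: "i \<in> ?S \<longleftrightarrow> remaining_steps T i \<le> 1" for i
    using nat_ceiling_le_eq[of "real T / 2 ^ i" 1] by (simp add: remaining_steps_def)
  have "real T / 2 ^ T \<le> 1"
    using of_nat_mono[OF less_imp_le[OF less_exp[of T]], where 'a = real] by simp
  then have "num_phases T \<in> ?S"
    unfolding num_phases_def by (intro Inf_nat_def1) blast
  moreover have "remaining_steps T (num_phases T) > 0" if "T \<ge> 1"
    using that by (simp add: remaining_steps_def)
  ultimately show "remaining_steps T (num_phases T) = 1" if "T \<ge> 1"
    using that S by fastforce
  show "remaining_steps T i \<ge> 2" if "i < num_phases T"
    using that S[of i] wellorder_Inf_le1[of i ?S] unfolding num_phases_def by fastforce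
qed

lemma remaining_steps_le: "remaining_steps T i \<le> T"
  by (induction i) (auto simp: remaining_steps_Suc)

lemma phase_time_remaining: "i \<le> num_phases T \<Longrightarrow> phase_time T i = T - remaining_steps T i"
  by (simp add: phase_time_def remaining_steps_def)

lemma phase_time_end: "phase_time T (Suc (num_phases T)) = T"
  by (simp add: phase_time_def)

lemma num_phases_ge_2: "T \<ge> 4 \<Longrightarrow> num_phases T \<ge> 2"
proof (rule ccontr)
  assume T: "T \<ge> 4" and "\<not> num_phases T \<ge> 2"
  then have "num_phases T = 0 \<or> num_phases T = 1" by auto
  moreover have "remaining_steps T 1 = (T + 1) div 2"
    using remaining_steps_Suc[of T 0] by simp
  ultimately show False
    using remaining_steps_num_phases[of T] T by auto
qed

lemma phase_time_less_Suc:
  assumes "T \<ge> 1" "i \<le> num_phases T"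
  shows "phase_time T i < phase_time T (Suc i)"
proof (cases "i = num_phases T")
  case True
  then show ?thesis
    using assms by (simp add: phase_time_end phase_time_remaining remaining_steps_num_phases)
next
  case False
  then show ?thesis
    using assms remaining_steps_before[of i T] remaining_steps_le[of T i]
    by (simp add: phase_time_remaining remaining_steps_Suc)
qed

text \<open>
  Roughly, the lengths halve. Rounding costs most when 6 steps remain, where the lengths are 3 and
  1; the last phase is special, as its length is 1 and not half of its remaining step.
\<close>

lemma phase_length_ratio:
  assumes "T \<ge> 1" "i < num_phases T"
  shows "phase_time T (Suc i) - phase_time T i
    \<le> 3 * (phase_time T (Suc (Suc i)) - phase_time T (Suc i))"
proof -
  define p q where "p = remaining_steps T i" and "q = remaining_steps T (Suc i)"
  have q: "q = (p + 1) div 2"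
    by (simp add: p_def q_def remaining_steps_Suc)
  have "p \<le> T" "q \<le> T"
    by (simp_all add: p_def q_def remaining_steps_le)
  then have first: "phase_time T (Suc i) - phase_time T i = p - q"
    using assms by (simp add: p_def q_def phase_time_remaining)
  show ?thesis
  proof (cases "Suc i = num_phases T")
    case True
    then have "q = 1" "phase_time T (Suc (Suc i)) - phase_time T (Suc i) = 1"
      using assms remaining_steps_num_phases[of T] phase_time_end[of T]
      by (simp_all add: q_def phase_time_remaining)
    then show ?thesis
      unfolding first using q by linarith
  next
    case False
    then have "q \<ge> 2"
      using assms remaining_steps_before by (simp add: q_def)
    have "phase_time T (Suc (Suc i)) - phase_time T (Suc i) = q - (q + 1) div 2"
      using False assms \<open>q \<le> T\<close> remaining_steps_Suc[of T "Suc i"]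
      by (simp add: q_def phase_time_remaining)
    then show ?thesis
      unfolding first using q \<open>q \<ge> 2\<close> by linarith
  qed
qed

lemma phase_time_1: "T \<ge> 4 \<Longrightarrow> phase_time T 1 = T div 2"
  using num_phases_ge_2[of T] phase_time_remaining[of 1 T] remaining_steps_Suc[of T 0] by simp

lemma ceiling_quarter: "nat \<lceil>real T / 4\<rceil> = ((T + 1) div 2 + 1) div 2"
  using remaining_steps_Suc[of T 0] remaining_steps_Suc[of T 1]
  by (simp add: remaining_steps_def power2_eq_square numeral_2_eq_2[symmetric])

lemma phase_time_2: "T \<ge> 4 \<Longrightarrow> phase_time T 2 = T - nat \<lceil>real T / 4\<rceil>"
  using num_phases_ge_2[of T] by (simp add: phase_time_def)

lemma phase_exists:
  assumes "1 \<le> t" "t \<le> T"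
  shows "\<exists>i\<le>num_phases T. phase_time T i < t \<and> t \<le> phase_time T (Suc i)"
proof -
  have "\<exists>i\<le>j. phase_time T i < t \<and> t \<le> phase_time T (Suc i)"
    if "t \<le> phase_time T (Suc j)" for j
    using that
  proof (induction j)
    case 0
    have "phase_time T 0 = 0"
      by (simp add: phase_time_remaining)
    then show ?case using 0 assms by auto
  next
    case (Suc j)
    then show ?case by (metis le_Suc_eq not_le)
  qed
  from this[of "num_phases T"] show ?thesis
    using assms by (simp add: phase_time_end)
qed

section \<open>The chain of best times\<close>

lemma decreasing_steps_antimono:
  assumes "decreasing_steps \<gamma>" "1 \<le> s" "s \<le> t"
  shows "\<gamma> t \<le> \<gamma> s"
  using assms(3)
proof (induction t rule: dec_induct)
  case (step n)
  then have "\<gamma> (n + 1) \<le> \<gamma> n"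
    using assms by (auto simp: decreasing_steps_def)
  then show ?case using step by simp
qed simp

lemma decay_second_half:
  assumes "decreasing_steps \<gamma>" "polynomial_decay \<beta> \<gamma>" "1 \<le> t" "T \<le> 2 * t" "T \<ge> 1"
  shows "\<beta> * \<gamma> t \<le> \<gamma> T"
proof -
  have "\<beta> * \<gamma> t \<le> \<gamma> (2 * t)"
    using assms(2,3) by (simp add: polynomial_decay_def)
  also have "\<dots> \<le> \<gamma> T"
    using assms by (intro decreasing_steps_antimono)
  finally show ?thesis .
qed

lemma decay_last_three_quarters:
  assumes "decreasing_steps \<gamma>" "polynomial_decay \<beta> \<gamma>" "1 \<le> t" "T \<le> 4 * t" "T \<ge> 1"
  shows "\<beta>\<^sup>2 * \<gamma> t \<le> \<gamma> T"
proof -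
  have "\<beta> * \<gamma> t \<le> \<gamma> (2 * t)" "\<beta> > 0"
    using assms by (auto simp: polynomial_decay_def)
  then have "\<beta> * (\<beta> * \<gamma> t) \<le> \<beta> * \<gamma> (2 * t)"
    by simp
  also have "\<dots> \<le> \<gamma> T"
    using assms by (intro decay_second_half) auto
  finally show ?thesis by (simp add: power2_eq_square mult.assoc)
qed

text \<open>
  The chain starts at \<open>a\<close> with \<open>R = 2\<close>, \<open>A = \<gamma> T / \<beta>\<^sup>2\<close>, \<open>B = \<gamma> T / (2 * \<beta>)\<close>, \<open>L = \<gamma> T / 2\<close> and
  continues from phase \<open>i\<close> with \<open>R = 3\<close>, \<open>A = \<gamma> T / (\<beta> * 2 ^ i)\<close>, \<open>B = A / 2\<close>,
  \<open>L = \<gamma> T / 2 ^ Suc i\<close>, where the loss is \<open>(3 + 1 / 4) * G\<^sup>2 * \<gamma> T / (\<beta>\<^sup>2 * 2 ^ i)\<close>.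
\<close>

lemma modified_steps_last_value:
  fixes e \<alpha> \<gamma> :: "nat \<Rightarrow> real"
  assumes T: "T \<ge> 4"
    and dec: "decreasing_steps \<gamma>" and decay: "polynomial_decay \<beta> \<gamma>"
    and modif: "step_modification T \<gamma> \<alpha>"
    and pos: "\<gamma> T > 0"
    and regret: "\<And>a b. 1 \<le> a \<Longrightarrow> a \<le> b \<Longrightarrow> b \<le> T \<Longrightarrow>
      (\<Sum>t=a..b. 2 * \<alpha> t * (e t - e a)) \<le> G\<^sup>2 * (\<Sum>t=a..b. (\<alpha> t)\<^sup>2)"
    and a: "nat \<lceil>real T / 4\<rceil> \<le> a" "a \<le> phase_time T 1"
    and a_min: "\<And>t. nat \<lceil>real T / 4\<rceil> \<le> t \<Longrightarrow> t \<le> phase_time T 1 \<Longrightarrow> e a \<le> e t"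
  shows "e T \<le> 5 * G\<^sup>2 * \<gamma> T * (1 / \<beta> ^ 2 + 1 / \<beta> ^ 4) + e a"
proof -
  let ?k = "num_phases T"
  let ?c = "\<lambda>i. e a + G\<^sup>2 * \<gamma> T * (2 / \<beta> ^ 4 + 1 / (4 * \<beta>\<^sup>2) + 13 / (4 * \<beta>\<^sup>2) * (1 - (1 / 2) ^ i))"
  have \<beta>: "0 < \<beta>" "\<beta> \<le> 1"
    using decay by (auto simp: polynomial_decay_def)
  have k: "?k \<ge> 2"
    using num_phases_ge_2[OF T] .
  have mod_eq: "\<alpha> t = \<gamma> t / 2 ^ i" if "i \<le> ?k" "phase_time T i < t" "t \<le> phase_time T (Suc i)" for i t
    using modif that by (simp add: step_modification_def)
  have time_le: "phase_time T i \<le> T" for i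
    by (simp add: phase_time_def)
  have time_mono: "phase_time T 1 \<le> phase_time T (Suc i)" if "i \<le> ?k" for i
    using that
  proof (induction i)
    case (Suc i)
    then show ?case
      using phase_time_less_Suc[of T "Suc i"] T by simp
  qed simp
  have late: "\<gamma> T / 2 ^ Suc i \<le> \<alpha> t \<and> \<alpha> t \<le> \<gamma> T / \<beta> / 2 ^ Suc i"
    if i: "Suc i \<le> ?k" and t: "phase_time T (Suc i) < t" "t \<le> phase_time T (Suc (Suc i))" for i t
  proof -
    have "t \<le> T" using t time_le order_trans by blast
    moreover have "T div 2 < t"
      using time_mono[of i] i t phase_time_1[OF T] by simp
    ultimately have "\<gamma> T \<le> \<gamma> t" "\<beta> * \<gamma> t \<le> \<gamma> T"
      using dec decay T by (auto intro!: decreasing_steps_antimono decay_second_half)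
    then show ?thesis
      using mod_eq[OF i t] \<beta> by (simp add: field_simps)
  qed
  \<comment> \<open>The best time \<open>c\<close> of phase \<open>Suc i\<close>; the factor \<open>1 - (1 / 2) ^ i\<close> sums the losses after the
    first.\<close>
  have blocks: "\<exists>c. phase_time T (Suc i) < c \<and> c \<le> phase_time T (Suc (Suc i))
      \<and> (\<forall>t. phase_time T (Suc i) < t \<and> t \<le> phase_time T (Suc (Suc i)) \<longrightarrow> e c \<le> e t) \<and> e c \<le> ?c i"
    if "i < ?k" for i
    using that
  proof (induction i)
    case 0
    \<comment> \<open>Only the part of phase 0 from time \<open>T / 4\<close> on enters; it has at most twice the length of
      phase 1.\<close>
    have lower: "T \<le> 4 * nat \<lceil>real T / 4\<rceil>"
      unfolding ceiling_quarter by linarith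
    have "\<exists>c. phase_time T 1 < c \<and> c \<le> phase_time T 2
      \<and> (\<forall>t. phase_time T 1 < t \<and> t \<le> phase_time T 2 \<longrightarrow> e c \<le> e t)
      \<and> e c \<le> e a + G\<^sup>2 * (2 * (\<gamma> T / \<beta>\<^sup>2)\<^sup>2 + (\<gamma> T / \<beta> / 2)\<^sup>2) / (2 * (\<gamma> T / 2))"
    proof (rule minimum_over_next_block)
      show "(\<Sum>t = a..phase_time T 2. 2 * \<alpha> t * (e t - e a)) \<le> G\<^sup>2 * (\<Sum>t = a..phase_time T 2. (\<alpha> t)\<^sup>2)"
        using lower a T time_mono[of 1] k time_le[of 2] by (intro regret) (auto simp: numeral_2_eq_2)
      show "phase_time T 1 < phase_time T 2"
        using phase_time_less_Suc[of T 1] k T by (simp add: numeral_2_eq_2)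
      show "0 \<le> \<alpha> t \<and> \<alpha> t \<le> \<gamma> T / \<beta>\<^sup>2" if t: "a \<le> t" "t \<le> phase_time T 1" for t
      proof -
        have t1: "1 \<le> t" "T \<le> 4 * t" using lower a t T by auto
        have "phase_time T 0 < t"
          using t1 by (simp add: phase_time_remaining)
        then have "\<alpha> t = \<gamma> t"
          using mod_eq[of 0 t] t by simp
        moreover have "\<beta>\<^sup>2 * \<gamma> t \<le> \<gamma> T" "0 \<le> \<gamma> t"
          using t1 dec decay T by (auto intro!: decay_last_three_quarters simp: decreasing_steps_def)
        ultimately show ?thesis
          using \<beta> by (simp add: field_simps)
      qed
      show "\<gamma> T / 2 \<le> \<alpha> t \<and> \<alpha> t \<le> \<gamma> T / \<beta> / 2" if "phase_time T 1 < t" "t \<le> phase_time T 2" for t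
        using late[of 0 t] that k by (simp add: numeral_2_eq_2)
      show "real (phase_time T 1 + 1 - a) \<le> 2 * real (phase_time T 2 - phase_time T 1)"
      proof -
        have "T div 2 + 1 - a \<le> 2 * (T - nat \<lceil>real T / 4\<rceil> - T div 2)"
          using a(1) T unfolding ceiling_quarter by linarith
        then show ?thesis
          unfolding phase_time_1[OF T] phase_time_2[OF T] by linarith
      qed
    qed (use a a_min pos in auto)
    moreover have "G\<^sup>2 * (2 * (\<gamma> T / \<beta>\<^sup>2)\<^sup>2 + (\<gamma> T / \<beta> / 2)\<^sup>2) / (2 * (\<gamma> T / 2))
        = G\<^sup>2 * \<gamma> T * (2 / \<beta> ^ 4 + 1 / (4 * \<beta>\<^sup>2))"
      using pos \<beta> by (simp add: field_simps power2_eq_square power4_eq_xxxx)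
    ultimately show ?case by (simp add: numeral_2_eq_2)
  next
    case (Suc i)
    let ?S = "phase_time T"
    from Suc obtain c where c: "?S (Suc i) < c" "c \<le> ?S (Suc (Suc i))"
      and c_min: "\<And>t. ?S (Suc i) < t \<Longrightarrow> t \<le> ?S (Suc (Suc i)) \<Longrightarrow> e c \<le> e t"
      and c_le: "e c \<le> ?c i"
      by auto
    let ?p = "2 ^ Suc i :: real"
    let ?X = "G\<^sup>2 * (3 * (\<gamma> T / \<beta> / ?p)\<^sup>2 + (\<gamma> T / \<beta> / (2 * ?p))\<^sup>2) / (2 * (\<gamma> T / (2 * ?p)))"
    let ?Y = "G\<^sup>2 * \<gamma> T * (13 / (4 * \<beta>\<^sup>2) * (1 / ?p))"
    have "\<exists>d. ?S (Suc (Suc i)) < d \<and> d \<le> ?S (Suc (Suc (Suc i)))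
      \<and> (\<forall>t. ?S (Suc (Suc i)) < t \<and> t \<le> ?S (Suc (Suc (Suc i))) \<longrightarrow> e d \<le> e t)
      \<and> e d \<le> e c + ?X"
    proof (rule minimum_over_next_block)
      show next_phase: "?S (Suc (Suc i)) < ?S (Suc (Suc (Suc i)))"
        using phase_time_less_Suc[of T "Suc (Suc i)"] Suc T by simp
      show "(\<Sum>t = c..?S (Suc (Suc (Suc i))). 2 * \<alpha> t * (e t - e c))
          \<le> G\<^sup>2 * (\<Sum>t = c..?S (Suc (Suc (Suc i))). (\<alpha> t)\<^sup>2)"
        using c next_phase time_le[of "Suc (Suc (Suc i))"] by (intro regret) auto
      show "0 \<le> \<alpha> t \<and> \<alpha> t \<le> \<gamma> T / \<beta> / ?p" if "c \<le> t" "t \<le> ?S (Suc (Suc i))" for t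
      proof -
        have "\<gamma> T / ?p \<le> \<alpha> t \<and> \<alpha> t \<le> \<gamma> T / \<beta> / ?p"
          using late[of i t] that c Suc by simp
        moreover have "0 \<le> \<gamma> T / ?p" using pos by simp
        ultimately show ?thesis by linarith
      qed
      show "\<gamma> T / (2 * ?p) \<le> \<alpha> t \<and> \<alpha> t \<le> \<gamma> T / \<beta> / (2 * ?p)"
        if "?S (Suc (Suc i)) < t" "t \<le> ?S (Suc (Suc (Suc i)))" for t
        using late[of "Suc i" t] that Suc by simp
      show "e c \<le> e t" if "c \<le> t" "t \<le> ?S (Suc (Suc i))" for t
        using c_min[of t] that c by simp
      have "?S (Suc (Suc i)) + 1 - c \<le> 3 * (?S (Suc (Suc (Suc i))) - ?S (Suc (Suc i)))"
        using phase_length_ratio[of T "Suc i"] Suc T c by simp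
      then show "real (?S (Suc (Suc i)) + 1 - c) \<le> 3 * real (?S (Suc (Suc (Suc i))) - ?S (Suc (Suc i)))"
        by linarith
    qed (use c pos in auto)
    then obtain d where d: "?S (Suc (Suc i)) < d" "d \<le> ?S (Suc (Suc (Suc i)))"
      "\<forall>t. ?S (Suc (Suc i)) < t \<and> t \<le> ?S (Suc (Suc (Suc i))) \<longrightarrow> e d \<le> e t"
      and d_le: "e d \<le> e c + ?X"
      by blast
    have X: "?X = ?Y"
    proof -
      have "?p > 0" by simp
      then show ?thesis
        using pos \<beta> by (simp only: power2_eq_square) (simp add: field_simps del: power_Suc)
    qed
    have "?c (Suc i) = ?c i + ?Y"
    proof -
      have halves: "1 / ?p = (1 / 2) ^ i / 2" "(1 / 2) ^ Suc i = (1 / 2 :: real) ^ i / 2"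
        by (simp_all add: power_one_over)
      have "u + K * (v + w * (1 - q / 2)) = u + K * (v + w * (1 - q)) + K * (w * (q / 2))"
        for u v w q K :: real
        by (simp add: algebra_simps)
      then show ?thesis
        unfolding halves .
    qed
    then have "e d \<le> ?c (Suc i)"
      using c_le d_le unfolding X by linarith
    with d show ?case by blast
  qed
  obtain j where j: "?k = Suc j"
    using k by (cases ?k) auto
  have "phase_time T (Suc j) = T - 1" "phase_time T (Suc (Suc j)) = T"
    using T phase_time_end[of T] unfolding j[symmetric]
    by (simp_all add: phase_time_remaining remaining_steps_num_phases)
  then obtain c where "T - 1 < c" "c \<le> T" "e c \<le> ?c j"
    using blocks[of j] unfolding j by auto
  moreover from this have "c = T" by simp
  ultimately have "e T \<le> ?c j" by simp
  also have "\<dots> \<le> 5 * G\<^sup>2 * \<gamma> T * (1 / \<beta> ^ 2 + 1 / \<beta> ^ 4) + e a"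
  proof -
    have bound: "13 / (4 * \<beta>\<^sup>2) * (1 - (1 / 2) ^ j) \<le> 13 / 4 * (1 / \<beta>\<^sup>2)"
      using mult_left_mono[of "1 - (1 / 2) ^ j" 1 "13 / (4 * \<beta>\<^sup>2)"] by simp
    have arith: "2 * p + q / 4 + w \<le> 5 * (q + p)"
      if "w \<le> 13 / 4 * q" "0 \<le> p" "0 \<le> q" for p q w :: real
      using that by simp
    have "2 * (1 / \<beta> ^ 4) + 1 / \<beta>\<^sup>2 / 4 + 13 / (4 * \<beta>\<^sup>2) * (1 - (1 / 2) ^ j)
        \<le> 5 * (1 / \<beta>\<^sup>2 + 1 / \<beta> ^ 4)"
      by (rule arith[OF bound]) simp_all
    then have "2 / \<beta> ^ 4 + 1 / (4 * \<beta>\<^sup>2) + 13 / (4 * \<beta>\<^sup>2) * (1 - (1 / 2) ^ j)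
        \<le> 5 * (1 / \<beta>\<^sup>2 + 1 / \<beta> ^ 4)"
      by (simp add: mult.commute)
    from mult_left_mono[OF this, of "G\<^sup>2 * \<gamma> T"] pos show ?thesis
      by (simp add: algebra_simps)
  qed
  finally show ?thesis .
qed

theorem theorem3:
  fixes M :: "'w measure"
    and W :: "'a::euclidean_space set"
    and F :: "'a \<Rightarrow> real"
    and xstar x1 :: 'a
    and g :: "nat \<Rightarrow> 'a \<Rightarrow> 'a"
    and gh :: "nat \<Rightarrow> 'w \<Rightarrow> 'a \<Rightarrow> 'a"
    and G \<beta> :: real
    and \<gamma> \<alpha> :: "nat \<Rightarrow> real"
    and T :: nat
    and x y :: "nat \<Rightarrow> 'w \<Rightarrow> 'a"
  assumes "prob_space M"
    and "closed W" and "convex W"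
    and "convex_on UNIV F"
    and "xstar \<in> W" and "\<forall>z. F xstar \<le> F z"
    and "stochastic_gradient_oracle M W F g gh"
    and "G_Lipschitz M W F gh G"
    and "decreasing_steps \<gamma>" and "polynomial_decay \<beta> \<gamma>"
    and "T \<ge> 4"
    and "step_modification T \<gamma> \<alpha>"
    and "x1 \<in> W"
    and "sgd_iterates M W gh \<gamma> x1 T y"
    and "sgd_iterates M W gh \<alpha> x1 T x"
  shows "(\<integral>\<omega>. F (x T \<omega>) \<partial>M)
           \<le> 5 * G\<^sup>2 * \<gamma> T * (1 / \<beta> ^ 2 + 1 / \<beta> ^ 4)
             + (INF t\<in>{nat \<lceil>real T / 4\<rceil>..phase_time T 1}. \<integral>\<omega>. F (y t \<omega>) \<partial>M)"
proof -
  obtain A where A: "\<forall>t\<ge>1. subalgebra M (A t)" "prob_space.indep_sets M (\<lambda>t. sets (A t)) {1..}"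
      "\<forall>t\<ge>1. (\<lambda>(\<omega>, x). gh t \<omega> x) \<in> borel_measurable (A t \<Otimes>\<^sub>M restrict_space borel W)"
    using assms(7) by (auto simp: stochastic_gradient_oracle_def indep_random_maps_def)
  interpret prob_space M by fact
  interpret sgd_oracle M W F g gh G A
    by unfold_locales
      (use assms A in \<open>auto simp: stochastic_gradient_oracle_def G_Lipschitz_def\<close>)
  note dec = assms(9) and decay = assms(10) and T = assms(11) and modif = assms(12)
  note x1 = assms(13) and y = assms(14) and x = assms(15)
  let ?q = "nat \<lceil>real T / 4\<rceil>"
  define e where "e t = (\<integral>\<omega>. F (x t \<omega>) \<partial>M)" for t
  have quarter: "1 \<le> ?q" "T \<le> 4 * ?q" "?q \<le> phase_time T 1"
    using T unfolding ceiling_quarter phase_time_1[OF T] by linarith+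
  have half: "phase_time T 1 \<le> T"
    by (simp add: phase_time_def)
  \<comment> \<open>In phase 0 the step sizes are unmodified, so up to its end the two runs agree.\<close>
  have same: "(\<integral>\<omega>. F (y t \<omega>) \<partial>M) = e t" if t: "1 \<le> t" "t \<le> phase_time T 1" for t
  proof -
    have "\<alpha> s = \<gamma> s" if "1 \<le> s" "s < t" for s
      using modif[unfolded step_modification_def, rule_format, of 0 s] that t
      by (simp add: phase_time_remaining)
    then have "y t \<omega> = x t \<omega>" if "\<omega> \<in> space M" for \<omega>
      using sgd_iterates_cong[OF x y _ _ _ that] t half by auto
    then show ?thesis
      unfolding e_def by (intro Bochner_Integration.integral_cong) auto
  qed
  let ?I = "(\<lambda>t. \<integral>\<omega>. F (y t \<omega>) \<partial>M) ` {?q..phase_time T 1}"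
  have "Inf ?I \<in> ?I"
    using quarter by (subst cInf_eq_Min) (auto intro!: Min_in)
  then obtain a where a: "?q \<le> a" "a \<le> phase_time T 1" and Inf_eq: "Inf ?I = (\<integral>\<omega>. F (y a \<omega>) \<partial>M)"
    by auto
  have a_range: "1 \<le> a" "a \<le> T"
    using a quarter half by linarith+
  have a_eq: "Inf ?I = e a"
    using Inf_eq same[of a] a quarter by simp
  have a_min: "e a \<le> e t" if t: "?q \<le> t" "t \<le> phase_time T 1" for t
  proof -
    have "Inf ?I \<le> (\<integral>\<omega>. F (y t \<omega>) \<partial>M)"
      using t by (intro cInf_lower) auto
    also have "\<dots> = e t"
      using t quarter by (intro same) linarith+
    finally show ?thesis
      unfolding a_eq .
  qed
  have \<alpha>: "\<exists>i. \<alpha> t = \<gamma> t / 2 ^ i" if "1 \<le> t" "t \<le> T" for t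
    using phase_exists[OF that] modif by (auto simp: step_modification_def)
  have \<gamma>_nonneg: "\<gamma> t \<ge> 0" if "1 \<le> t" for t
    using dec that by (simp add: decreasing_steps_def)
  have \<alpha>_nonneg: "\<alpha> t \<ge> 0" if "1 \<le> t" "t \<le> T" for t
    using \<alpha>[OF that] \<gamma>_nonneg[of t] that by auto
  have "e T \<le> 5 * G\<^sup>2 * \<gamma> T * (1 / \<beta> ^ 2 + 1 / \<beta> ^ 4) + e a"
  proof (cases "\<gamma> T = 0")
    case True
    have "\<alpha> t = 0" if t: "a \<le> t" "t < T" for t
    proof -
      have "\<beta>\<^sup>2 * \<gamma> t \<le> 0"
        using decay_last_three_quarters[OF dec decay, of t T] t a quarter T True by simp
      then have "\<gamma> t = 0"
        using \<gamma>_nonneg[of t] t a quarter decay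
        by (simp add: polynomial_decay_def mult_le_0_iff)
      then show ?thesis
        using \<alpha>[of t] t a quarter by auto
    qed
    then have "x T \<omega> = x a \<omega>" if "\<omega> \<in> space M" for \<omega>
      using a_range by (intro constant_without_steps[OF x x1 _ _ order_refl _ that]) auto
    then have "e T = e a"
      unfolding e_def by (intro Bochner_Integration.integral_cong) auto
    then show ?thesis using True by simp
  next
    case False
    then have "\<gamma> T > 0"
      using \<gamma>_nonneg[of T] T by simp
    moreover have "(\<Sum>t=r..s. 2 * \<alpha> t * (e t - e r)) \<le> G\<^sup>2 * (\<Sum>t=r..s. (\<alpha> t)\<^sup>2)"
      if "1 \<le> r" "r \<le> s" "s \<le> T" for r s
      unfolding e_def using that \<alpha>_nonneg
      by (intro expected_regret_earlier_iterate[OF x x1]) auto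
    ultimately show ?thesis
      using a a_min by (intro modified_steps_last_value[OF T dec decay modif])
  qed
  then show ?thesis
    unfolding a_eq by (simp add: e_def)
qed

end
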